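(* Let $\mathcal F$ be a filter on $\omega$. The following are equivalent: (1) the forcing $\mathbb M(\mathcal F)$ does not add an eventually different real; (2) the filter $\mathcal F^{<\omega}$ is $+$-selective; (3) the filter $\mathcal F^{<\omega}$ is $+$-Ramsey.
   Context: All filters are proper and extend the Fréchet filter (contain all cofinite subsets of their countable domain). For a filter $\mathcal G$ on a countable set $D$, $\mathcal G^+$ is the family of sets $X\subseteq D$ with $D\setminus X\notin\mathcal G$. Let $\mathrm{fin}=[\omega]^{<\omega}$ be the set of finite subsets of $\omega$. For a filter $\mathcal F$ on $\omega$, $\mathcal F^{<\omega}$ is the filter on $\mathrm{fin}$ generated by the sets $[F]^{<\omega}$, $F\in\mathcal F$, together with the cofinite subsets of $\mathrm{fin}$. Thus $X\subseteq\mathrm{fin}$ is in $(\mathcal F^{<\omega})^+$ iff for each $F\in\mathcal F$ there is a nonempty $a\in X$ with $a\subseteq F$ (equivalently, infinitely many such $a$). A filter $\mathcal G$ on a countable set $D$ is $+$-selective if for every sequence $\{X_n : n\in\omega\}\subseteq\mathcal G^+$ there are $a_n\in X_n$ ($n\in\omega$) with $\{a_n : n\in\omega\}\in\mathcal G^+$. A $\mathcal G^+$-tree is a nonempty initial subtree $T$ of $D^{<\omega}$ (the finite sequences of elements of $D$, ordered by extension) such that for every node $t\in T$, $\{d\in D : t^\frown d\in T\}\in\mathcal G^+$. $\mathcal G$ is $+$-Ramsey if every $\mathcal G^+$-tree $T$ has a maximal branch $b\in D^\omega$ with $b[\omega]=\{b(n) : n\in\omega\}\in\mathcal G^+$. The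 Mathias--Prikry forcing $\mathbb M(\mathcal F)$ consists of pairs $(s,A)$ with $s\in\mathrm{fin}$ and $A\in\mathcal F$, ordered by $(s,A)\le(t,B)$ iff $t\sqsubseteq s$ (i.e. $t=s\cap n$ for some $n\in\omega$), $A\subseteq B$, and $s\setminus t\subseteq B$. A real $r\in\omega^\omega$ in an extension of $V$ is eventually different over $V$ if $\{n : r(n)=f(n)\}$ is finite for each $f\in\omega^\omega\cap V$. A forcing does not add an eventually different real if no generic extension of $V$ by it contains an eventually different real over $V$. *)

theory Defs
  imports Main "HOL-Library.FSet" "HOL-Library.Sublist"
begin

text \<open>
  A filter on a set \<open>D\<close> is an element of \<^typ>\<open>'d filter\<close>, where the type \<open>'d\<close> plays the role of
  \<open>D\<close>; a set \<open>A\<close> belongs to \<open>G\<close> iff \<^term>\<open>eventually (\<lambda>d. d \<in> A) G\<close>. In the library \<^term>\<open>bot\<close> is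
  the improper filter and finer filters are smaller, so ``proper and extending the Frechet filter''
  is \<open>G \<noteq> bot \<and> G \<le> cofinite\<close>. The set of finite subsets of \<open>\<omega>\<close> is the type \<^typ>\<open>nat fset\<close>.
\<close>

definition filter_sets :: "'d filter \<Rightarrow> 'd set set" where
  "filter_sets G = {A. eventually (\<lambda>d. d \<in> A) G}"

definition positive :: "'d filter \<Rightarrow> 'd set set" where
  "positive G = {X. - X \<notin> filter_sets G}"

definition fin_power :: "nat filter \<Rightarrow> nat fset filter" where
  "fin_power F = inf (INF A\<in>filter_sets F. principal {a. fset a \<subseteq> A}) cofinite"

lemma positive_fin_power_iff:
  "X \<in> positive (fin_power F) \<longleftrightarrow> (\<forall>A\<in>filter_sets F. infinite {a \<in> X. fset a \<subseteq> A})"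
proof -
  let ?B = "INF A\<in>filter_sets F. principal {a. fset a \<subseteq> A}"
  have base: "eventually Q ?B \<longleftrightarrow> (\<exists>A\<in>filter_sets F. \<forall>a. fset a \<subseteq> A \<longrightarrow> Q a)" for Q
  proof (subst eventually_INF_base)
    show "filter_sets F \<noteq> {}"
      by (auto simp: filter_sets_def intro!: exI[of _ UNIV])
    show "\<exists>C\<in>filter_sets F. principal {a. fset a \<subseteq> C} \<le>
            inf (principal {a. fset a \<subseteq> A}) (principal {a. fset a \<subseteq> B})"
      if "A \<in> filter_sets F" "B \<in> filter_sets F" for A B
      using that by (intro bexI[of _ "A \<inter> B"]) (auto simp: filter_sets_def eventually_conj)
  qed (simp add: eventually_principal)
  have "- X \<in> filter_sets (fin_power F) \<longleftrightarrow>
      (\<exists>A\<in>filter_sets F. finite {a \<in> X. fset a \<subseteq> A})"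
  proof
    assume "- X \<in> filter_sets (fin_power F)"
    then obtain Q R where Q: "eventually Q ?B" and R: "finite {a. \<not> R a}"
      and QR: "\<And>a. Q a \<and> R a \<Longrightarrow> a \<notin> X"
      by (auto simp: filter_sets_def fin_power_def eventually_inf eventually_cofinite)
    from Q obtain A where A: "A \<in> filter_sets F" "\<And>a. fset a \<subseteq> A \<Longrightarrow> Q a"
      by (auto simp: base)
    have "finite {a \<in> X. fset a \<subseteq> A}"
      using R by (rule finite_subset[rotated]) (use A QR in auto)
    with A show "\<exists>A\<in>filter_sets F. finite {a \<in> X. fset a \<subseteq> A}" by blast
  next
    assume "\<exists>A\<in>filter_sets F. finite {a \<in> X. fset a \<subseteq> A}"
    then obtain A where A: "A \<in> filter_sets F" "finite {a \<in> X. fset a \<subseteq> A}" by blast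
    have "eventually (\<lambda>a. fset a \<subseteq> A) ?B"
      using A by (auto simp: base)
    moreover have "eventually (\<lambda>a. \<not> (a \<in> X \<and> fset a \<subseteq> A)) cofinite"
      using A by (simp add: eventually_cofinite)
    ultimately show "- X \<in> filter_sets (fin_power F)"
      unfolding filter_sets_def fin_power_def mem_Collect_eq eventually_inf by blast
  qed
  then show ?thesis by (auto simp: positive_def)
qed

definition plus_selective :: "'d filter \<Rightarrow> bool" where
  "plus_selective G \<longleftrightarrow>
     (\<forall>X :: nat \<Rightarrow> 'd set. (\<forall>n. X n \<in> positive G) \<longrightarrow>
        (\<exists>a. (\<forall>n. a n \<in> X n) \<and> range a \<in> positive G))"

definition positive_tree :: "'d filter \<Rightarrow> 'd list set \<Rightarrow> bool" where
  "positive_tree G T \<longleftrightarrow>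
     T \<noteq> {} \<and> (\<forall>t\<in>T. \<forall>s. prefix s t \<longrightarrow> s \<in> T) \<and>
     (\<forall>t\<in>T. {d. t @ [d] \<in> T} \<in> positive G)"

definition plus_Ramsey :: "'d filter \<Rightarrow> bool" where
  "plus_Ramsey G \<longleftrightarrow>
     (\<forall>T. positive_tree G T \<longrightarrow>
        (\<exists>b :: nat \<Rightarrow> 'd. (\<forall>n. map b [0..<n] \<in> T) \<and> range b \<in> positive G))"


text \<open>
  A forcing is a set \<open>P\<close> of conditions with a preorder \<open>le\<close>; \<open>le q p\<close> means that \<open>q\<close> is the stronger
  condition. The ground model is the universe of the logic, and statements about generic extensions
  are expressed through the forcing relation. A name for a subset of \<open>\<omega> \<times> \<omega>\<close> is a set of pairs
  consisting of a condition and (the canonical name of) an element of \<open>\<omega> \<times> \<omega>\<close>; its value at a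
  generic filter \<open>H\<close> is \<open>{x. \<exists>p\<in>H. (p, x) \<in> \<tau>}\<close>. Every subset of \<open>\<omega> \<times> \<omega>\<close> in a generic extension,
  and so every real, is the value of such a name.
\<close>

definition binary_names :: "'p set \<Rightarrow> ('p \<times> (nat \<times> nat)) set set" where
  "binary_names P = Pow (P \<times> UNIV)"

text \<open>
  Formulas about one binary relation on \<open>\<omega>\<close>, with quantifiers over \<open>\<omega>\<close> and over the reals of the
  ground model. \<open>Rel n m\<close> says that \<open>(n, m)\<close> belongs to the relation; \<open>Ground b\<close> is a statement
  about the ground model, with truth value \<open>b\<close>.
\<close>

datatype formula =
    Rel nat nat
  | Ground bool
  | Neg formula
  | And formula formula
  | All_nat "nat \<Rightarrow> formula"
  | All_ground_real "(nat \<Rightarrow> nat) \<Rightarrow> formula"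

definition Imp :: "formula \<Rightarrow> formula \<Rightarrow> formula" where
  "Imp \<phi> \<psi> = Neg (And \<phi> (Neg \<psi>))"

definition Ex_nat :: "(nat \<Rightarrow> formula) \<Rightarrow> formula" where
  "Ex_nat \<phi> = Neg (All_nat (\<lambda>n. Neg (\<phi> n)))"

primrec holds :: "(nat \<times> nat) set \<Rightarrow> formula \<Rightarrow> bool" where
  "holds R (Rel n m) \<longleftrightarrow> (n, m) \<in> R"
| "holds R (Ground b) \<longleftrightarrow> b"
| "holds R (Neg \<phi>) \<longleftrightarrow> \<not> holds R \<phi>"
| "holds R (And \<phi> \<psi>) \<longleftrightarrow> holds R \<phi> \<and> holds R \<psi>"
| "holds R (All_nat \<Phi>) \<longleftrightarrow> (\<forall>n. holds R (\<Phi> n))"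
| "holds R (All_ground_real \<Phi>) \<longleftrightarrow> (\<forall>f. holds R (\<Phi> f))"

primrec forces ::
  "'p set \<Rightarrow> ('p \<Rightarrow> 'p \<Rightarrow> bool) \<Rightarrow> ('p \<times> (nat \<times> nat)) set \<Rightarrow> formula \<Rightarrow> 'p \<Rightarrow> bool" where
  "forces P le \<tau> (Rel n m) p \<longleftrightarrow>
     (\<forall>q\<in>P. le q p \<longrightarrow> (\<exists>u\<in>P. le u q \<and> (\<exists>w. (w, (n, m)) \<in> \<tau> \<and> le u w)))"
| "forces P le \<tau> (Ground b) p \<longleftrightarrow> b"
| "forces P le \<tau> (Neg \<phi>) p \<longleftrightarrow> (\<forall>q\<in>P. le q p \<longrightarrow> \<not> forces P le \<tau> \<phi> q)"
| "forces P le \<tau> (And \<phi> \<psi>) p \<longleftrightarrow> forces P le \<tau> \<phi> p \<and> forces P le \<tau> \<psi> p"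
| "forces P le \<tau> (All_nat \<Phi>) p \<longleftrightarrow> (\<forall>n. forces P le \<tau> (\<Phi> n) p)"
| "forces P le \<tau> (All_ground_real \<Phi>) p \<longleftrightarrow> (\<forall>f. forces P le \<tau> (\<Phi> f) p)"

definition is_real :: formula where
  "is_real = All_nat (\<lambda>n. And
     (Ex_nat (\<lambda>m. Rel n m))
     (All_nat (\<lambda>m. All_nat (\<lambda>m'. Imp (And (Rel n m) (Rel n m')) (Ground (m = m'))))))"

text \<open>Finiteness of \<open>{n. r n = f n}\<close> is expressed by boundedness.\<close>

definition eventually_different_real :: formula where
  "eventually_different_real = And is_real
     (All_ground_real (\<lambda>f. Ex_nat (\<lambda>k. All_nat (\<lambda>n.
        Imp (Ground (k \<le> n)) (Neg (Rel n (f n)))))))"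

lemma holds_eventually_different_real:
  "holds R eventually_different_real \<longleftrightarrow>
     (\<exists>r :: nat \<Rightarrow> nat. R = {(n, r n) | n. True} \<and> (\<forall>f. finite {n. r n = f n}))"
proof -
  have graph: "holds R is_real \<longleftrightarrow> (\<exists>r. R = {(n, r n) | n. True})"
  proof
    assume "holds R is_real"
    then have "\<forall>n. \<exists>!m. (n, m) \<in> R"
      by (auto simp: is_real_def Ex_nat_def Imp_def)
    then obtain r where "\<forall>n m. (n, m) \<in> R \<longleftrightarrow> m = r n"
      by metis
    then show "\<exists>r. R = {(n, r n) | n. True}"
      by (intro exI[of _ r]) auto
  qed (auto simp: is_real_def Ex_nat_def Imp_def)
  have bounded: "finite A \<longleftrightarrow> (\<exists>k. \<forall>n\<ge>k. n \<notin> A)" for A :: "nat set"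
    by (metis finite_nat_set_iff_bounded not_less)
  show ?thesis
    unfolding eventually_different_real_def
    by (auto simp: graph Ex_nat_def Imp_def bounded) (metis+)?
qed

text \<open>
  By the forcing theorem, some generic extension contains an eventually different real iff some
  condition forces some name to denote one.
\<close>

definition adds_eventually_different_real :: "'p set \<Rightarrow> ('p \<Rightarrow> 'p \<Rightarrow> bool) \<Rightarrow> bool" where
  "adds_eventually_different_real P le \<longleftrightarrow>
     (\<exists>p\<in>P. \<exists>\<tau>\<in>binary_names P. forces P le \<tau> eventually_different_real p)"


definition mathias_conditions :: "nat filter \<Rightarrow> (nat fset \<times> nat set) set" where
  "mathias_conditions F = UNIV \<times> filter_sets F"

fun mathias_le :: "nat fset \<times> nat set \<Rightarrow> nat fset \<times> nat set \<Rightarrow> bool" where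
  "mathias_le (s, A) (t, B) \<longleftrightarrow>
     (\<exists>n. fset t = fset s \<inter> {..<n}) \<and> A \<subseteq> B \<and> fset s - fset t \<subseteq> B"

end

theory Submission
  imports Defs "HOL-Library.Infinite_Set"
begin

text \<open>
  If \<open>fin_power F\<close> is \<open>+\<close>-selective and \<open>r\<close> names a real, then for each stem \<open>s\<close> and each \<open>n\<close> the sets
  \<open>a\<close> above \<open>s\<close> such that some \<open>(s \<union> a, B)\<close> decides \<open>r n\<close> form a positive set. Selecting
  from these along infinitely many \<open>n\<close> for each \<open>s\<close> yields a ground model real that meets \<open>r\<close>
  infinitely often. Conversely, if the sets \<open>X n\<close> witness that \<open>+\<close>-selectivity fails, the generic
  subset of \<open>\<omega>\<close> picks \<open>r n \<in> X n\<close> inside its tail beyond \<open>n\<close>; a ground model selection meeting \<open>r\<close>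
  infinitely often would be positive.

  For \<open>+\<close>-Ramseyness the argument follows the theorems of Hurewicz and Pawlikowski on the Menger and
  Rothberger games. From a positive tree one first finds a finitely branching subtree such that for
  every \<open>A \<in> F\<close> there are infinitely many levels all of whose nodes have a successor in the subtree
  contained in \<open>A\<close>. For each \<open>k\<close>, the sets that do this on more than \<open>k\<close> levels are positive;
  a positive selection of them is assigned injectively to levels, and this determines a branch.
\<close>

section \<open>Filter sets and positive sets of finite subsets\<close>

lemma filter_sets_Int:
  "A \<in> filter_sets F \<Longrightarrow> B \<in> filter_sets F \<Longrightarrow> A \<inter> B \<in> filter_sets F"
  by (simp add: filter_sets_def eventually_conj)

lemma filter_sets_UNIV: "UNIV \<in> filter_sets F"
  by (simp add: filter_sets_def)

lemma filter_sets_cofinite: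
  assumes "F \<le> cofinite" "finite K"
  shows "- K \<in> filter_sets F"
  using filter_leD[OF assms(1), of "\<lambda>x. x \<in> - K"] assms(2)
  by (simp add: filter_sets_def eventually_cofinite)

lemma filter_sets_atLeast:
  fixes F :: "nat filter"
  assumes "F \<le> cofinite" "A \<in> filter_sets F"
  shows "A \<inter> {n..} \<in> filter_sets F"
  using filter_sets_Int[OF assms(2) filter_sets_cofinite[OF assms(1), of "{..<n}"]]
  by (simp add: Compl_lessThan)

lemma filter_sets_nonempty: "F \<noteq> bot \<Longrightarrow> A \<in> filter_sets F \<Longrightarrow> A \<noteq> {}"
  by (auto simp: filter_sets_def eventually_False)

text \<open>If only finitely many elements of \<open>X\<close> lay inside \<open>A\<close>, removing
  their finite union \<open>K\<close> from \<open>A\<close> would leave a filter set containing no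
  nonempty element of \<open>X\<close>.\<close>

lemma positive_fin_power_iff_nonempty:
  assumes "F \<le> cofinite"
  shows "X \<in> positive (fin_power F) \<longleftrightarrow> (\<forall>A\<in>filter_sets F. \<exists>a\<in>X. a \<noteq> {||} \<and> fset a \<subseteq> A)"
proof
  assume X: "X \<in> positive (fin_power F)"
  show "\<forall>A\<in>filter_sets F. \<exists>a\<in>X. a \<noteq> {||} \<and> fset a \<subseteq> A"
  proof
    fix A assume "A \<in> filter_sets F"
    with X have "infinite {a \<in> X. fset a \<subseteq> A}" by (simp add: positive_fin_power_iff)
    then have "\<not> {a \<in> X. fset a \<subseteq> A} \<subseteq> {{||}}" using finite_subset by blast
    then show "\<exists>a\<in>X. a \<noteq> {||} \<and> fset a \<subseteq> A" by blast
  qed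
next
  assume X: "\<forall>A\<in>filter_sets F. \<exists>a\<in>X. a \<noteq> {||} \<and> fset a \<subseteq> A"
  show "X \<in> positive (fin_power F)"
    unfolding positive_fin_power_iff
  proof (intro ballI notI)
    fix A assume A: "A \<in> filter_sets F" and fin: "finite {a \<in> X. fset a \<subseteq> A}"
    define K where "K = (\<Union>a\<in>{a \<in> X. fset a \<subseteq> A}. fset a)"
    have "finite K" using fin by (simp add: K_def)
    then have "A \<inter> - K \<in> filter_sets F"
      using A assms by (intro filter_sets_Int filter_sets_cofinite)
    with X obtain a where a: "a \<in> X" "a \<noteq> {||}" "fset a \<subseteq> A \<inter> - K" by blast
    from a(1,3) have "fset a \<subseteq> K" unfolding K_def by (intro UN_upper) simp
    with a(3) have "fset a = {}" by blast
    with a(2) show False by (metis bot_fset.rep_eq fset_inject)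
  qed
qed

lemma positive_nonempty_sets:
  assumes "F \<le> cofinite" "X \<in> positive (fin_power F)"
  shows "X - {{||}} \<in> positive (fin_power F)"
  using assms(2) unfolding positive_fin_power_iff_nonempty[OF assms(1)]
  by (metis DiffI singletonD)

text \<open>Finite sequences whose entry \<open>i\<close> comes from \<open>X i\<close> form a
  positive tree, and a branch of it is a selection.\<close>

lemma plus_Ramsey_imp_plus_selective:
  fixes G :: "'d filter"
  assumes "plus_Ramsey G"
  shows "plus_selective G"
  unfolding plus_selective_def
proof (intro allI impI)
  fix X :: "nat \<Rightarrow> 'd set" assume X: "\<forall>n. X n \<in> positive G"
  let ?T = "{t. \<forall>i<length t. t ! i \<in> X i}"
  have "positive_tree G ?T"
    unfolding positive_tree_def
  proof (intro conjI ballI allI impI)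
    show "?T \<noteq> {}" by (auto intro: exI[of _ "[]"])
    fix t assume t: "t \<in> ?T"
    show "s \<in> ?T" if "prefix s t" for s
      using that t by (auto simp: prefix_def nth_append) (metis trans_less_add1)
    have "{d. t @ [d] \<in> ?T} = X (length t)"
      using t by (auto simp: nth_append less_Suc_eq)
    with X show "{d. t @ [d] \<in> ?T} \<in> positive G" by simp
  qed
  with assms obtain b where b: "\<forall>n. map b [0..<n] \<in> ?T" "range b \<in> positive G"
    unfolding plus_Ramsey_def by blast
  have "b n \<in> X n" for n
    using b(1)[rule_format, of "Suc n"] by (auto simp: less_Suc_eq nth_append)
  with b(2) show "\<exists>a. (\<forall>n. a n \<in> X n) \<and> range a \<in> positive G" by blast
qed

subsection \<open>From selections to branches\<close>

text \<open>The default successor keeps every level nonempty; otherwise an empty level would be captured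
  vacuously.\<close>
primrec levels :: "(nat fset list \<Rightarrow> nat fset set) \<Rightarrow> (nat \<Rightarrow> nat) \<Rightarrow> nat \<Rightarrow> nat fset list set" where
  "levels X b 0 = {[]}"
| "levels X b (Suc n) = (\<Union>t\<in>levels X b n.
     (\<lambda>a. t @ [a]) ` {a \<in> X t. to_nat a < b n \<or> a = (SOME a. a \<in> X t)})"

text \<open>For \<open>S = levels X b n\<close> and \<open>m = b n\<close> the code bound is the one
  by which \<open>levels\<close> admits successors, so each node of level \<open>n\<close> then has
  a successor inside \<open>A\<close> on level \<open>n + 1\<close>.\<close>

definition captures ::
  "(nat fset list \<Rightarrow> nat fset set) \<Rightarrow> nat set \<Rightarrow> nat fset list set \<Rightarrow> nat \<Rightarrow> bool" where
  "captures X A S m \<longleftrightarrow> (\<forall>t\<in>S. \<exists>a\<in>X t. fset a \<subseteq> A \<and> to_nat a < m)"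

lemma finite_to_nat_less: "finite {a :: 'a :: countable. to_nat a < m}"
  by (rule finite_imageD[of to_nat]) (auto intro: finite_subset[of _ "{..<m}"])

lemma finite_levels: "finite (levels X b n)"
proof (induction n)
  case (Suc n)
  have "finite {a \<in> X t. to_nat a < b n \<or> a = (SOME a. a \<in> X t)}" for t
    by (rule finite_subset[of _ "insert (SOME a. a \<in> X t) {a. to_nat a < b n}"])
      (auto simp: finite_to_nat_less)
  with Suc show ?case by simp
qed simp

lemma levels_SucI:
  assumes "t \<in> levels X b n" "a \<in> X t" "to_nat a < b n \<or> a = (SOME a. a \<in> X t)"
  shows "t @ [a] \<in> levels X b (Suc n)"
  unfolding levels.simps by (intro UN_I[OF assms(1)] image_eqI[OF refl]) (use assms in simp)

lemma levels_nonempty: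
  assumes "\<And>t. X t \<noteq> {}"
  shows "levels X b n \<noteq> {}"
proof (induction n)
  case (Suc n)
  then obtain t where "t \<in> levels X b n" by blast
  moreover have "(SOME a. a \<in> X t) \<in> X t" using assms[of t] by (simp add: some_in_eq)
  ultimately have "t @ [SOME a. a \<in> X t] \<in> levels X b (Suc n)"
    by (intro levels_SucI) simp_all
  then show ?case by blast
qed simp

lemma levels_mono:
  assumes "\<And>j. j < n \<Longrightarrow> b j \<le> c j"
  shows "levels X b n \<subseteq> levels X c n"
  using assms
proof (induction n)
  case (Suc n)
  have "levels X b n \<subseteq> levels X c n" "b n \<le> c n" using Suc by auto
  then show ?case unfolding levels.simps by (intro UN_mono image_mono) auto
qed simp

lemma levels_cong: "(\<And>j. j < n \<Longrightarrow> b j = c j) \<Longrightarrow> levels X b n = levels X c n"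
  by (intro equalityI levels_mono) simp_all

lemma captures_mono:
  "captures X A S m \<Longrightarrow> A \<subseteq> A' \<Longrightarrow> S' \<subseteq> S \<Longrightarrow> m \<le> m' \<Longrightarrow> captures X A' S' m'"
  unfolding captures_def by (meson order_less_le_trans subset_trans subset_eq)

lemma ex_captures:
  assumes "finite S" "\<And>t. \<exists>a\<in>X t. fset a \<subseteq> A"
  shows "\<exists>m. captures X A S m"
proof -
  from assms(2) obtain g where g: "\<And>t. g t \<in> X t" "\<And>t. fset (g t) \<subseteq> A" by metis
  have "to_nat (g t) < Suc (\<Sum>t\<in>S. to_nat (g t))" if "t \<in> S" for t
    using member_le_sum[of t S "\<lambda>t. to_nat (g t)"] that assms(1) by simp
  with g show ?thesis unfolding captures_def by blast
qed

text \<open>One successor per node of the finite set \<open>S\<close> is enough, and the union of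
  these is a finite subset of \<open>A\<close>. Thus a capturing filter set is replaced by an
  element of \<open>fin\<close>, to which selectivity can be applied.\<close>

lemma captures_fset:
  assumes "finite S" "captures X A S m"
  shows "\<exists>a. fset a \<subseteq> A \<and> captures X (fset a) S m"
proof -
  from assms(2) obtain g where g: "\<And>t. t \<in> S \<Longrightarrow> g t \<in> X t \<and> fset (g t) \<subseteq> A \<and> to_nat (g t) < m"
    unfolding captures_def by metis
  have "finite (\<Union>t\<in>S. fset (g t))" using assms(1) by simp
  then obtain a where a: "fset a = (\<Union>t\<in>S. fset (g t))"
    by (metis Abs_fset_inverse mem_Collect_eq)
  with g show ?thesis unfolding captures_def by (intro exI[of _ a]) blast
qed

lemma captures_fset_family:
  assumes "finite I" "\<And>n. finite (S n)" "\<And>n. n \<in> I \<Longrightarrow> captures X A (S n) (m n)"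
  shows "\<exists>a. fset a \<subseteq> A \<and> (\<forall>n\<in>I. captures X (fset a) (S n) (m n))"
  using assms(1,3)
proof (induction I)
  case empty
  then show ?case by (intro exI[of _ "{||}"]) simp
next
  case (insert n I)
  obtain a where a: "fset a \<subseteq> A" "\<forall>n\<in>I. captures X (fset a) (S n) (m n)"
    using insert.IH[OF insert.prems] by auto
  obtain a' where a': "fset a' \<subseteq> A" "captures X (fset a') (S n) (m n)"
    using captures_fset[OF assms(2) insert.prems[OF insertI1]] by auto
  show ?case
  proof (intro exI[of _ "a |\<union>| a'"] conjI ballI)
    show "fset (a |\<union>| a') \<subseteq> A" using a(1) a'(1) by simp
    show "captures X (fset (a |\<union>| a')) (S k) (m k)" if "k \<in> insert n I" for k
    proof (cases "k = n")
      case True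
      then show ?thesis using captures_mono[OF a'(2), of "fset (a |\<union>| a')"] by simp
    next
      case False
      then have "captures X (fset a) (S k) (m k)" using that a(2) by blast
      from captures_mono[OF this, of "fset (a |\<union>| a')"] show ?thesis by simp
    qed
  qed
qed

lemma captures_imp_nonempty:
  assumes "captures X (fset a) S m" "S \<noteq> {}" "\<And>t. {||} \<notin> X t"
  shows "a \<noteq> {||}"
  using assms unfolding captures_def
  by (metis bot.extremum_uniqueI bot_fset.rep_eq ex_in_conv fset_inject)

text \<open>Level \<open>n\<close> is finite and depends only on \<open>c\<close> below
  \<open>n\<close>, so for a fixed \<open>A\<close> the bounds can be chosen by recursion.\<close>

lemma ex_captures_levels:
  assumes "\<And>t. \<exists>a\<in>X t. fset a \<subseteq> A"
  shows "\<exists>c. \<forall>n. captures X A (levels X c n) (c n)"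
proof -
  have "\<exists>m. captures X A (levels X c n) m" for c n
    using assms by (intro ex_captures finite_levels)
  then show ?thesis
  proof (intro dependent_wf_choice[of less_than "\<lambda>c n m. captures X A (levels X c n) m"])
    fix f g :: "nat \<Rightarrow> nat" and n m assume "\<And>j. (j, n) \<in> less_than \<Longrightarrow> f j = g j"
    then have "levels X f n = levels X g n" by (intro levels_cong) simp
    then show "captures X A (levels X f n) m = captures X A (levels X g n) m" by simp
  qed simp_all
qed

text \<open>The bounds from \<open>ex_captures_levels\<close> depend on \<open>A\<close>;
  \<open>+\<close>-selectivity yields a single \<open>b\<close>, hence a single finitely branching
  tree, for all filter sets.\<close>

lemma selective_captures:
  assumes frechet: "F \<le> cofinite" and sel: "plus_selective (fin_power F)"
    and pos: "\<And>t. X t \<in> positive (fin_power F)" and ne: "\<And>t. {||} \<notin> X t"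
  shows "\<exists>b. \<forall>A\<in>filter_sets F. \<exists>n. captures X A (levels X b n) (b n)"
proof -
  note posI = positive_fin_power_iff_nonempty[OF frechet]
  have X: "\<exists>a\<in>X t. fset a \<subseteq> A" if "A \<in> filter_sets F" for A t
    using pos[of t] that unfolding posI by blast
  then have Xne: "X t \<noteq> {}" for t using filter_sets_UNIV by fastforce
  \<comment> \<open>If \<open>A\<close> escapes \<open>b\<close> and contains \<open>a \<in> Z n\<close> with witness \<open>c\<close>, then inductively \<open>b j < c j\<close>
    for all \<open>j \<le> n\<close>; so \<open>b\<close> is taken as the diagonal of the witnesses.\<close>
  define Z where "Z n = {a. \<exists>c. \<forall>j\<le>n. captures X (fset a) (levels X c j) (c j)}" for n :: nat
  have "Z n \<in> positive (fin_power F)" for n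
    unfolding posI
  proof
    fix A assume "A \<in> filter_sets F"
    then obtain c where c: "\<And>n. captures X A (levels X c n) (c n)"
      using ex_captures_levels[of X A] X by blast
    obtain a where a: "fset a \<subseteq> A" "\<forall>j\<in>{..n}. captures X (fset a) (levels X c j) (c j)"
      using captures_fset_family[of "{..n}" "levels X c" X A c] c finite_levels by blast
    then have "a \<noteq> {||}"
      using captures_imp_nonempty[of X a "levels X c 0"] ne by fastforce
    moreover have "a \<in> Z n" using a(2) unfolding Z_def by blast
    ultimately show "\<exists>a\<in>Z n. a \<noteq> {||} \<and> fset a \<subseteq> A" using a(1) by blast
  qed
  with sel obtain a where a: "\<And>n. a n \<in> Z n" "range a \<in> positive (fin_power F)"
    unfolding plus_selective_def by blast
  have "\<forall>n. \<exists>c. \<forall>j\<le>n. captures X (fset (a n)) (levels X c j) (c j)"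
    using a(1) by (simp add: Z_def)
  then obtain c where c: "\<And>n j. j \<le> n \<Longrightarrow> captures X (fset (a n)) (levels X (c n) j) (c n j)"
    by metis
  define b where "b n = c n n" for n
  show ?thesis
  proof (intro exI[of _ b] ballI, rule ccontr)
    fix A assume "A \<in> filter_sets F" and no: "\<nexists>n. captures X A (levels X b n) (b n)"
    with a(2) obtain n where n: "fset (a n) \<subseteq> A" unfolding posI by blast
    \<comment> \<open>Below \<open>j\<close> the values of \<open>b\<close> are smaller than those
      of \<open>c n\<close>, so level \<open>j\<close> for \<open>b\<close> lies inside level
      \<open>j\<close> for \<open>c n\<close> and is captured with bound \<open>c n j\<close>. A
      value \<open>b j\<close> at least as large would capture it too, contrary to
      \<open>no\<close>.\<close>
    have "b j < c n j" if "j \<le> n" for j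
      using that
    proof (induction j rule: less_induct)
      case (less j)
      then have "levels X b j \<subseteq> levels X (c n) j" by (intro levels_mono) (simp add: less_imp_le)
      then have "captures X A (levels X b j) (c n j)"
        using c[OF less.prems] n by (blast intro: captures_mono)
      with no show ?case by (meson captures_mono not_less subset_refl)
    qed
    then show False by (auto simp: b_def)
  qed
qed

lemma captures_infinitely_often:
  fixes F :: "nat filter"
  assumes frechet: "F \<le> cofinite"
    and pos: "\<And>t. X t \<noteq> {}" and ne: "\<And>t. {||} \<notin> X t"
    and b: "\<forall>A\<in>filter_sets F. \<exists>n. captures X A (levels X b n) (b n)"
    and A: "A \<in> filter_sets F"
  shows "infinite {n. captures X A (levels X b n) (b n)}"
proof
  assume fin: "finite {n. captures X A (levels X b n) (b n)}" (is "finite ?N")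
  define K where "K = (\<Union>n\<in>?N. \<Union>a\<in>{a :: nat fset. to_nat a < b n}. fset a)"
  have "finite K" using fin by (simp add: K_def finite_to_nat_less)
  then have "A \<inter> - K \<in> filter_sets F"
    using A frechet by (intro filter_sets_Int filter_sets_cofinite)
  with b obtain n where n: "captures X (A \<inter> - K) (levels X b n) (b n)" by blast
  then have "n \<in> ?N" by (auto intro: captures_mono)
  obtain t where "t \<in> levels X b n" using levels_nonempty[of X b n] pos by blast
  with n obtain a where a: "a \<in> X t" "fset a \<subseteq> A \<inter> - K" "to_nat a < b n"
    unfolding captures_def by blast
  have "fset a \<subseteq> K" unfolding K_def using \<open>n \<in> ?N\<close> a(3) by blast
  with a(2) have "fset a = {}" by blast
  with a ne show False by (metis bot_fset.rep_eq fset_inject)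
qed

text \<open>Greedy choice: the \<open>k\<close> earlier values cannot exhaust
  \<open>I k\<close>.\<close>

lemma ex_inj_choice:
  fixes I :: "nat \<Rightarrow> 'a set"
  assumes "\<And>k. finite (I k)" "\<And>k. k < card (I k)"
  shows "\<exists>h. inj h \<and> (\<forall>k. h k \<in> I k)"
proof -
  have "\<exists>h. \<forall>k. h k \<in> I k - h ` {..<k}"
  proof (rule dependent_wf_choice[of less_than])
    fix h :: "nat \<Rightarrow> 'a" and k
    have "card (h ` {..<k}) < card (I k)"
      using card_image_le[of "{..<k}" h] assms(2)[of k] by simp
    then have "\<not> I k \<subseteq> h ` {..<k}"
      by (meson card_mono finite_imageI finite_lessThan not_less)
    then show "\<exists>r. r \<in> I k - h ` {..<k}" by blast
  next
    fix f g :: "nat \<Rightarrow> 'a" and k r assume "\<And>y. (y, k) \<in> less_than \<Longrightarrow> f y = g y"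
    then have "f ` {..<k} = g ` {..<k}" by (intro image_cong) auto
    then show "(r \<in> I k - f ` {..<k}) = (r \<in> I k - g ` {..<k})" by simp
  qed simp
  then obtain h where h: "\<And>k. h k \<in> I k - h ` {..<k}" by blast
  then have "inj h" by (intro linorder_injI) (metis DiffD2 imageI lessThan_iff)
  with h show ?thesis by blast
qed

lemma plus_selective_imp_plus_Ramsey:
  assumes frechet: "F \<le> cofinite" and sel: "plus_selective (fin_power F)"
  shows "plus_Ramsey (fin_power F)"
  unfolding plus_Ramsey_def
proof (intro allI impI)
  fix T assume T: "positive_tree (fin_power F) T"
  note posI = positive_fin_power_iff_nonempty[OF frechet]
  \<comment> \<open>Off the tree every nonempty set counts as a successor, which makes
    \<open>X\<close> positive at all sequences.\<close>
  define X where "X t = {d. t \<in> T \<longrightarrow> t @ [d] \<in> T} - {{||}}" for t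
  have pos: "X t \<in> positive (fin_power F)" for t
  proof (cases "t \<in> T")
    case True
    then have "{d. t @ [d] \<in> T} \<in> positive (fin_power F)"
      using T by (simp add: positive_tree_def)
    then show ?thesis
      using True positive_nonempty_sets[OF frechet] by (simp add: X_def)
  next
    case False
    \<comment> \<open>A positive successor set at any node of \<open>T\<close> shows that
      \<open>fin_power F\<close> is proper, hence that \<open>UNIV\<close> is positive.\<close>
    obtain t' where "t' \<in> T" using T by (auto simp: positive_tree_def)
    then have "{d. t' @ [d] \<in> T} \<in> positive (fin_power F)"
      using T by (simp add: positive_tree_def)
    then have "UNIV \<in> positive (fin_power F)"
      unfolding positive_def filter_sets_def by (auto simp: eventually_False)
    then show ?thesis
      using False positive_nonempty_sets[OF frechet] by (simp add: X_def)
  qed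
  then have Xne: "X t \<noteq> {}" for t unfolding posI using filter_sets_UNIV[of F] by fastforce
  have ne: "{||} \<notin> X t" for t by (simp add: X_def)
  obtain b where b: "\<forall>A\<in>filter_sets F. \<exists>n. captures X A (levels X b n) (b n)"
    using selective_captures[where X = X, OF frechet sel pos ne] by blast
  let ?S = "levels X b"
  define W where "W k = {a. \<exists>I. finite I \<and> k < card I \<and> (\<forall>n\<in>I. captures X (fset a) (?S n) (b n))}"
    for k
  have "W k \<in> positive (fin_power F)" for k
    unfolding posI
  proof
    fix A assume "A \<in> filter_sets F"
    then have "infinite {n. captures X A (?S n) (b n)}"
      using captures_infinitely_often[where X = X, OF frechet Xne ne b] by blast
    then obtain I where I: "I \<subseteq> {n. captures X A (?S n) (b n)}" "finite I" "card I = Suc k"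
      by (meson infinite_arbitrarily_large)
    then obtain a where a: "fset a \<subseteq> A" "\<forall>n\<in>I. captures X (fset a) (?S n) (b n)"
      using captures_fset_family[of I ?S X A b] finite_levels by blast
    obtain n where "n \<in> I" using I(3) by fastforce
    with a have "a \<noteq> {||}"
      using captures_imp_nonempty[of X a "?S n"] levels_nonempty[of X b n] Xne ne by blast
    moreover have "a \<in> W k"
      unfolding W_def using a(2) I(2,3) by (intro CollectI exI[of _ I]) simp
    ultimately show "\<exists>a\<in>W k. a \<noteq> {||} \<and> fset a \<subseteq> A" using a(1) by blast
  qed
  with sel obtain w where w: "\<And>k. w k \<in> W k" "range w \<in> positive (fin_power F)"
    unfolding plus_selective_def by blast
  have "\<forall>k. \<exists>I. finite I \<and> k < card I \<and> (\<forall>n\<in>I. captures X (fset (w k)) (?S n) (b n))"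
    using w(1) by (simp add: W_def)
  then obtain I where I: "\<And>k. finite (I k)" "\<And>k. k < card (I k)"
    "\<And>k n. n \<in> I k \<Longrightarrow> captures X (fset (w k)) (?S n) (b n)"
    by metis
  obtain h where h: "inj h" "\<And>k. h k \<in> I k" using ex_inj_choice[OF I(1,2)] by blast
  \<comment> \<open>At level \<open>h k\<close> the successor has to lie inside \<open>w k\<close>;
    injectivity of \<open>h\<close> means that at most one \<open>k\<close> imposes this. The branch
    also has to stay in \<open>?S\<close>, since capturing speaks only about nodes there.\<close>
  define good where "good t a \<longleftrightarrow> t @ [a] \<in> ?S (Suc (length t)) \<and> a \<in> X t \<and>
    (\<forall>k. length t = h k \<longrightarrow> fset a \<subseteq> fset (w k))" for t a
  have good: "\<exists>a. good t a" if t: "t \<in> ?S (length t)" for t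
  proof (cases "\<exists>k. length t = h k")
    case True
    then obtain k where k: "length t = h k" by blast
    with I(3)[OF h(2)[of k]] t obtain a where a: "a \<in> X t" "fset a \<subseteq> fset (w k)" "to_nat a < b (h k)"
      unfolding captures_def by auto
    moreover have "t @ [a] \<in> ?S (Suc (length t))"
      using levels_SucI[OF t a(1)] a(3) k by simp
    ultimately have "good t a" using k h(1) by (auto simp: good_def inj_eq)
    then show ?thesis ..
  next
    case False
    \<comment> \<open>On a level outside the range of \<open>h\<close> the default successor
      suffices: \<open>levels\<close> admits it whatever its code.\<close>
    moreover have "(SOME a. a \<in> X t) \<in> X t" using Xne[of t] by (simp add: some_in_eq)
    ultimately have "good t (SOME a. a \<in> X t)"
      using levels_SucI[OF t] by (simp add: good_def del: levels.simps)
    then show ?thesis ..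
  qed
  define br where "br = rec_nat [] (\<lambda>_ t. t @ [SOME a. good t a])"
  define c where "c n = (SOME a. good (br n) a)" for n
  have br_Suc: "br (Suc n) = br n @ [c n]" for n by (simp add: br_def c_def)
  have br0: "br 0 = []" by (simp add: br_def)
  have br: "br n = map c [0..<n]" for n by (induction n) (simp_all add: br0 br_Suc)
  have len: "length (br n) = n" for n by (simp add: br)
  have c: "good (br n) (c n)" if "br n \<in> ?S n" for n
    unfolding c_def by (rule someI_ex) (use good[of "br n"] that len in simp)
  have S: "br n \<in> ?S n" for n
  proof (induction n)
    case (Suc n)
    from c[OF this] show ?case by (simp only: good_def len br_Suc)
  qed (simp add: br0)
  have "[] \<in> T" using T unfolding positive_tree_def by (metis Nil_prefix ex_in_conv)
  then have "br n \<in> T" for n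
  proof (induction n)
    case (Suc n)
    then show ?case using c[OF S, of n] by (simp add: good_def br_Suc X_def)
  qed (simp add: br0)
  moreover have "range c \<in> positive (fin_power F)"
    unfolding posI
  proof
    fix A assume "A \<in> filter_sets F"
    \<comment> \<open>A selected \<open>w k\<close> inside \<open>A\<close> forces the entry of the
      branch at level \<open>h k\<close> into \<open>A\<close>.\<close>
    with w(2) obtain k where "fset (w k) \<subseteq> A" unfolding posI by blast
    with c[OF S, of "h k"] have "c (h k) \<noteq> {||}" "fset (c (h k)) \<subseteq> A"
      using ne by (auto simp: good_def len)
    then show "\<exists>a\<in>range c. a \<noteq> {||} \<and> fset a \<subseteq> A" by blast
  qed
  ultimately show "\<exists>c. (\<forall>n. map c [0..<n] \<in> T) \<and> range c \<in> positive (fin_power F)"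
    unfolding br by blast
qed

subsection \<open>Eventually different reals\<close>

lemma mathias_le_subset:
  assumes "A \<subseteq> B"
  shows "mathias_le (s, A) (s, B)"
proof -
  obtain n where "fset s \<subseteq> {..<n}" using finite_nat_iff_bounded finite_fset by blast
  with assms show ?thesis by auto
qed

lemma mathias_le_refl: "mathias_le p p"
  using mathias_le_subset[of "snd p" "snd p" "fst p"] by simp

lemma mathias_le_trans:
  assumes "mathias_le p q" "mathias_le q r"
  shows "mathias_le p r"
proof -
  obtain s A t B u C where eqs: "p = (s, A)" "q = (t, B)" "r = (u, C)"
    by (metis surj_pair)
  from assms(1) obtain n where n: "fset t = fset s \<inter> {..<n}" "A \<subseteq> B" "fset s - fset t \<subseteq> B"
    by (auto simp only: eqs mathias_le.simps)
  from assms(2) obtain m where m: "fset u = fset t \<inter> {..<m}" "B \<subseteq> C" "fset t - fset u \<subseteq> C"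
    by (auto simp only: eqs mathias_le.simps)
  have "fset u = fset s \<inter> {..<min n m}" unfolding m(1) n(1) by auto
  moreover have "fset s - fset u \<subseteq> C" using n(3) m(2,3) by blast
  ultimately show ?thesis using n(2) m(2) unfolding eqs mathias_le.simps by blast
qed

lemma reflp_mathias_le: "reflp mathias_le"
  by (rule reflpI) (rule mathias_le_refl)

lemma transp_mathias_le: "transp mathias_le"
  by (rule transpI) (rule mathias_le_trans)

lemma mathias_le_end_extension:
  assumes "fset s \<subseteq> {..<n}" "fset a \<subseteq> B \<inter> {n..}" "A \<subseteq> B"
  shows "mathias_le (s |\<union>| a, A) (s, B)"
proof -
  have "fset s = fset (s |\<union>| a) \<inter> {..<n}" using assms(1,2) by (auto dest: subsetD)
  then show ?thesis using assms unfolding mathias_le.simps by auto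
qed

lemma mathias_leD:
  assumes "mathias_le (s, A) (t, B)"
  shows "fset t \<subseteq> fset s" "fset s - fset t \<subseteq> B" "A \<subseteq> B"
  using assms unfolding mathias_le.simps by blast+

section \<open>Forcing statements about reals\<close>

lemma forces_is_real_total:
  assumes "forces P le \<tau> is_real p" "q \<in> P" "le q p"
  shows "\<exists>m. \<exists>u\<in>P. le u q \<and> forces P le \<tau> (Rel n m) u"
  using assms unfolding is_real_def Ex_nat_def forces.simps(3-6) by blast

lemma forces_is_realI:
  assumes refl: "\<And>p. le p p"
    and total: "\<And>n q. q \<in> P \<Longrightarrow> le q p \<Longrightarrow> \<exists>m. \<exists>u\<in>P. le u q \<and> forces P le \<tau> (Rel n m) u"
    and unique: "\<And>n m m' q. q \<in> P \<Longrightarrow> forces P le \<tau> (Rel n m) q \<Longrightarrow> forces P le \<tau> (Rel n m') q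
      \<Longrightarrow> m = m'"
  shows "forces P le \<tau> is_real p"
  unfolding is_real_def Ex_nat_def Imp_def forces.simps(2-6)
proof (intro allI conjI ballI impI notI)
  show False if "q \<in> P" "le q p" "\<forall>m. \<forall>u\<in>P. le u q \<longrightarrow> \<not> forces P le \<tau> (Rel n m) u" for n q
    using total[OF that(1,2), of n] that(3) by blast
  show False if "q \<in> P" "(forces P le \<tau> (Rel n m) q \<and> forces P le \<tau> (Rel n m') q) \<and>
    (\<forall>u\<in>P. le u q \<longrightarrow> m \<noteq> m')" for n m m' q
    using unique[OF that(1), of n m m'] that refl[of q] by blast
qed

text \<open>Unfolding \<open>Imp\<close> leaves a doubly negated \<open>Rel\<close>, which says that
  conditions forcing \<open>Rel\<close> are dense. Since a forced \<open>Rel\<close> persists to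
  stronger conditions, excluding this density everywhere below \<open>u\<close> amounts to excluding
  every single condition below \<open>u\<close> that forces \<open>Rel\<close>.\<close>

lemma forces_eventually_different_real_iff:
  assumes "reflp le" "transp le"
  shows "forces P le \<tau> eventually_different_real p \<longleftrightarrow>
    forces P le \<tau> is_real p \<and>
    (\<forall>f. \<forall>q\<in>P. le q p \<longrightarrow> (\<exists>k. \<exists>u\<in>P. le u q \<and>
       (\<forall>n\<ge>k. \<forall>v\<in>P. le v u \<longrightarrow> \<not> forces P le \<tau> (Rel n (f n)) v)))"
proof -
  note refl = reflpD[OF assms(1)] and trans = transpD[OF assms(2)]
  define D where "D n m u \<longleftrightarrow> forces P le \<tau> (Rel n m) u" for n m u
  have mono: "D n m w" if "D n m v" "le w v" for n m v w
    using that(1) trans[OF _ that(2)] unfolding D_def forces.simps(1) by blast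
  have "(\<forall>v\<in>P. le v u \<longrightarrow> \<not> (k \<le> n \<and> (\<forall>w\<in>P. le w v \<longrightarrow> \<not> (\<forall>z\<in>P. le z w \<longrightarrow> \<not> D n m z)))) \<longleftrightarrow>
        (k \<le> n \<longrightarrow> (\<forall>v\<in>P. le v u \<longrightarrow> \<not> D n m v))" (is "?L \<longleftrightarrow> ?R") for u k n m
  proof
    show ?R if ?L
      using that mono refl by blast
    show ?L if ?R
    proof (intro ballI impI notI, elim conjE)
      fix v assume v: "v \<in> P" "le v u" "k \<le> n"
        and *: "\<forall>w\<in>P. le w v \<longrightarrow> \<not> (\<forall>z\<in>P. le z w \<longrightarrow> \<not> D n m z)"
      from * v(1) refl obtain z where "z \<in> P" "le z v" "D n m z" by blast
      with that v trans show False by blast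
    qed
  qed
  then show ?thesis
    unfolding eventually_different_real_def Ex_nat_def Imp_def forces.simps(2-6) D_def[symmetric]
    by simp
qed

lemmas mathias_forces_eventually_different_real_iff =
  forces_eventually_different_real_iff[OF reflp_mathias_le transp_mathias_le]

section \<open>Guessing a named real from the ground model\<close>

lemma plus_selective_imp_not_adds:
  assumes proper: "F \<noteq> bot" and frechet: "F \<le> cofinite"
    and sel: "plus_selective (fin_power F)"
  shows "\<not> adds_eventually_different_real (mathias_conditions F) mathias_le"
proof
  let ?P = "mathias_conditions F"
  assume "adds_eventually_different_real ?P mathias_le"
  then obtain p \<tau> where p0: "p \<in> ?P" "forces ?P mathias_le \<tau> eventually_different_real p"
    unfolding adds_eventually_different_real_def by blast
  note edr = p0(2)[unfolded mathias_forces_eventually_different_real_iff]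
  note p = p0(1) conjunct1[OF edr]
  have different: "\<And>f q. q \<in> ?P \<Longrightarrow> mathias_le q p \<Longrightarrow> \<exists>k. \<exists>u\<in>?P. mathias_le u q \<and>
       (\<forall>n\<ge>k. \<forall>v\<in>?P. mathias_le v u \<longrightarrow> \<not> forces ?P mathias_le \<tau> (Rel n (f n)) v)"
    using conjunct2[OF edr] by blast
  define D where "D n m u \<longleftrightarrow> forces ?P mathias_le \<tau> (Rel n m) u" for n m u
  have D_mono: "D n m v" if "D n m u" "mathias_le v u" for n m u v
    using that(1) mathias_le_trans[OF _ that(2)] unfolding D_def forces.simps(1) by blast
  define X where "X s n = {a. (\<exists>N. fset s \<subseteq> {..<N} \<and> fset a \<subseteq> {N..}) \<and>
    (\<exists>m. \<exists>B\<in>filter_sets F. D n m (s |\<union>| a, B))}" for s n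
  have X: "X s n \<in> positive (fin_power F)" if A: "A \<in> filter_sets F" "mathias_le (s, A) p" for s A n
    unfolding positive_fin_power_iff_nonempty[OF frechet]
  proof
    fix C assume C: "C \<in> filter_sets F"
    obtain N where N: "fset s \<subseteq> {..<N}" using finite_nat_iff_bounded finite_fset by blast
    define A1 where "A1 = A \<inter> C \<inter> {N..}"
    have A1: "A1 \<in> filter_sets F"
      unfolding A1_def by (intro filter_sets_atLeast filter_sets_Int frechet A C)
    \<comment> \<open>A point \<open>j\<close> of the reservoir is put into the stem before
      \<open>r n\<close> is decided, so that the part \<open>a\<close> added to \<open>s\<close> is
      nonempty.\<close>
    obtain j where j: "j \<in> A1" using filter_sets_nonempty[OF proper A1] by blast
    have "mathias_le (s |\<union>| {|j|}, A1) (s, A)"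
      by (rule mathias_le_end_extension[OF N]) (use j in \<open>auto simp: A1_def\<close>)
    then have "mathias_le (s |\<union>| {|j|}, A1) p" using A(2) mathias_le_trans by blast
    moreover have "(s |\<union>| {|j|}, A1) \<in> ?P" using A1 by (simp add: mathias_conditions_def)
    ultimately obtain m t B where B: "(t, B) \<in> ?P" "mathias_le (t, B) (s |\<union>| {|j|}, A1)" "D n m (t, B)"
      using forces_is_real_total[OF p(2)] unfolding D_def by (metis surj_pair)
    define a where "a = t |-| s"
    have sub: "fset s \<subseteq> fset t" "j \<in> fset t" using mathias_leD(1)[OF B(2)] by auto
    then have t: "s |\<union>| a = t" unfolding a_def by (auto simp flip: fset_inject)
    have a: "fset a \<subseteq> A1" using mathias_leD(2)[OF B(2)] j by (auto simp: a_def)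
    have "j |\<in>| a" using sub(2) j N by (auto simp: a_def A1_def)
    then have "a \<noteq> {||}" by blast
    moreover have "B \<in> filter_sets F" using B(1) by (simp add: mathias_conditions_def)
    then have "a \<in> X s n" using a N B(3) t unfolding X_def A1_def by blast
    moreover have "fset a \<subseteq> C" using a by (auto simp: A1_def)
    ultimately show "\<exists>a\<in>X s n. a \<noteq> {||} \<and> fset a \<subseteq> C" by blast
  qed
  \<comment> \<open>Pairing gives each stem its own infinite set of coordinates, so one real
    \<open>f\<close> carries the guesses for all stems. As \<open>code s n\<close> is at least
    \<open>n\<close>, large \<open>n\<close> give large coordinates.\<close>
  define code where "code s n = prod_encode (to_nat s, n)" for s :: "nat fset" and n
  \<comment> \<open>Positivity of \<open>X s n\<close> has been shown for stems of conditions below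
    \<open>p\<close>.\<close>
  define compatible where "compatible s \<longleftrightarrow> (\<exists>A\<in>filter_sets F. mathias_le (s, A) p)" for s
  have "\<exists>a. compatible s \<longrightarrow> (\<forall>n. a n \<in> X s (code s n)) \<and> range a \<in> positive (fin_power F)" for s
  proof (cases "compatible s")
    case True
    then have "\<forall>n. X s (code s n) \<in> positive (fin_power F)" using X unfolding compatible_def by blast
    with sel[unfolded plus_selective_def, rule_format, of "\<lambda>n. X s (code s n)"]
    show ?thesis by blast
  qed simp
  then obtain a where a: "\<And>s n. compatible s \<Longrightarrow> a s n \<in> X s (code s n)"
    "\<And>s. compatible s \<Longrightarrow> range (a s) \<in> positive (fin_power F)"
    by metis
  define guess where "guess s n = (SOME m. \<exists>B\<in>filter_sets F. D (code s n) m (s |\<union>| a s n, B))" for s n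
  define f where "f i = (case prod_decode i of (x, n) \<Rightarrow> guess (from_nat x) n)" for i
  have f: "f (code s n) = guess s n" for s n by (simp add: f_def code_def)
  obtain k s A where u: "(s, A) \<in> ?P" "mathias_le (s, A) p"
    and no: "\<And>n v. n \<ge> k \<Longrightarrow> v \<in> ?P \<Longrightarrow> mathias_le v (s, A) \<Longrightarrow> \<not> D n (f n) v"
    using different[OF p(1) mathias_le_refl, of f] unfolding D_def by (metis surj_pair)
  have A: "A \<in> filter_sets F" using u(1) by (simp add: mathias_conditions_def)
  then have s: "compatible s" using u(2) unfolding compatible_def by blast
  \<comment> \<open>Infinitely many selected sets lie inside \<open>A\<close>, so one of them has an
    index beyond \<open>k\<close>.\<close>
  have "infinite {x \<in> range (a s). fset x \<subseteq> A}"
    using a(2)[OF s] A by (simp add: positive_fin_power_iff)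
  then have "\<not> {x \<in> range (a s). fset x \<subseteq> A} \<subseteq> a s ` {..<k}"
    using finite_subset by blast
  then obtain n where n: "n \<ge> k" "fset (a s n) \<subseteq> A" using not_less by blast
  obtain N where N: "fset s \<subseteq> {..<N}" "fset (a s n) \<subseteq> {N..}" using a(1)[OF s, of n] by (auto simp: X_def)
  have "\<exists>m. \<exists>B\<in>filter_sets F. D (code s n) m (s |\<union>| a s n, B)"
    using a(1)[OF s, of n] by (simp add: X_def)
  then have "\<exists>B\<in>filter_sets F. D (code s n) (guess s n) (s |\<union>| a s n, B)"
    unfolding guess_def by (rule someI_ex)
  then obtain B where B: "B \<in> filter_sets F" "D (code s n) (f (code s n)) (s |\<union>| a s n, B)"
    unfolding f by blast
  \<comment> \<open>The reservoir \<open>A \<inter> B\<close> keeps the decision made with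
    \<open>B\<close>, while \<open>a s n\<close>, lying in \<open>A\<close> and beyond
    \<open>s\<close>, makes \<open>?v\<close> a condition below \<open>(s, A)\<close>.\<close>
  let ?v = "(s |\<union>| a s n, A \<inter> B)"
  have "D (code s n) (f (code s n)) ?v"
    using B(2) by (rule D_mono) (rule mathias_le_subset[OF Int_lower2])
  moreover have "?v \<in> ?P"
    using filter_sets_Int[OF A B(1)] by (simp add: mathias_conditions_def)
  moreover have "mathias_le ?v (s, A)"
    by (rule mathias_le_end_extension[OF N(1)]) (use n(2) N(2) in auto)
  moreover have "code s n \<ge> k"
    using n(1) le_prod_encode_2[of n "to_nat s"] by (simp add: code_def)
  ultimately show False using no by blast
qed

section \<open>The real chosen by the generic set\<close>

lemma not_plus_selective_imp_adds:
  assumes frechet: "F \<le> cofinite" and nsel: "\<not> plus_selective (fin_power F)"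
  shows "adds_eventually_different_real (mathias_conditions F) mathias_le"
proof -
  let ?P = "mathias_conditions F"
  note posI = positive_fin_power_iff_nonempty[OF frechet]
  obtain Y :: "nat \<Rightarrow> nat fset set" where Y: "\<And>n. Y n \<in> positive (fin_power F)"
    "\<And>a. (\<And>n. a n \<in> Y n) \<Longrightarrow> range a \<notin> positive (fin_power F)"
    using nsel unfolding plus_selective_def by blast
  \<comment> \<open>With the empty set removed, a selection that is not positive leaves a filter set
    containing no selected set at all.\<close>
  define X where "X n = Y n - {{||}}" for n :: nat
  have Xpos: "X n \<in> positive (fin_power F)" for n
    unfolding X_def by (rule positive_nonempty_sets[OF frechet Y(1)])
  have Xne: "{||} \<notin> X n" for n by (simp add: X_def)
  \<comment> \<open>\<open>a\<close> is the element of \<open>X n\<close> with least code inside the part of the generic set beyond \<open>n\<close>;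
    \<open>s \<union> A\<close> bounds the generic set from above, so that \<open>val\<close> persists to stronger conditions.\<close>
  define val where "val s A n a \<longleftrightarrow> a \<in> X n \<and> fset a \<subseteq> fset s \<inter> {n..} \<and>
    (\<forall>a'\<in>X n. to_nat a' < to_nat a \<longrightarrow> \<not> fset a' \<subseteq> (fset s \<union> A) \<inter> {n..})" for s A n a
  define \<tau> where "\<tau> = {((s, A), (n, to_nat a)) | s A n a. A \<in> filter_sets F \<and> val s A n a}"
  have \<tau>: "\<tau> \<in> binary_names ?P"
    by (auto simp: \<tau>_def binary_names_def mathias_conditions_def)
  define D where "D n m u \<longleftrightarrow> forces ?P mathias_le \<tau> (Rel n m) u" for n m u
  have val_mono: "val s' A' n a" if "val s A n a" "mathias_le (s', A') (s, A)" for s A s' A' n a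
  proof -
    have "fset s \<subseteq> fset s'" "fset s' \<union> A' \<subseteq> fset s \<union> A" using mathias_leD[OF that(2)] by blast+
    with that(1) show ?thesis unfolding val_def by blast
  qed
  have val_D: "D n (to_nat a) (s, A)" if "val s A n a" "A \<in> filter_sets F" for s A n a
    unfolding D_def forces.simps(1)
  proof (intro ballI impI)
    fix q assume "q \<in> ?P" "mathias_le q (s, A)"
    moreover have "((s, A), (n, to_nat a)) \<in> \<tau>" using that unfolding \<tau>_def by blast
    ultimately show "\<exists>u\<in>?P. mathias_le u q \<and> (\<exists>w. (w, (n, to_nat a)) \<in> \<tau> \<and> mathias_le u w)"
      using mathias_le_refl by blast
  qed
  have D_val: "\<exists>s' A' a. A' \<in> filter_sets F \<and> mathias_le (s', A') u \<and> val s' A' n a \<and> m = to_nat a"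
    if u: "D n m u" "u \<in> ?P" for n m u
  proof -
    obtain v w where v: "v \<in> ?P" "mathias_le v u" "(w, (n, m)) \<in> \<tau>" "mathias_le v w"
      using u mathias_le_refl unfolding D_def forces.simps(1) by blast
    obtain s A a where w: "w = (s, A)" "val s A n a" "m = to_nat a"
      using v(3) unfolding \<tau>_def by blast
    obtain s' A' where s': "v = (s', A')" by (cases v)
    have "A' \<in> filter_sets F" using v(1) s' by (simp add: mathias_conditions_def)
    moreover have "val s' A' n a" by (rule val_mono[OF w(2) v(4)[unfolded s' w(1)]])
    ultimately show ?thesis using v(2) w(3) unfolding s' by blast
  qed
  have dense: "\<exists>s' A' a. A' \<in> filter_sets F \<and> mathias_le (s', A') (s, A) \<and> val s' A' n a"
    if A: "A \<in> filter_sets F" for s A n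
  proof -
    obtain N where N: "fset s \<subseteq> {..<N}" using finite_nat_iff_bounded finite_fset by blast
    \<comment> \<open>The reservoir is first moved beyond \<open>s\<close>, so that adding
      \<open>a - s\<close> end-extends the stem. The added points come from \<open>A1\<close>, so
      the upper bound \<open>s \<union> A1\<close> does not grow and \<open>a\<close> keeps the
      least code.\<close>
    define A1 where "A1 = A \<inter> {N..}"
    have A1: "A1 \<in> filter_sets F" unfolding A1_def by (rule filter_sets_atLeast[OF frechet A])
    define C where "C a \<longleftrightarrow> a \<in> X n \<and> fset a \<subseteq> (fset s \<union> A1) \<inter> {n..}" for a
    have "A1 \<inter> {n..} \<in> filter_sets F" by (rule filter_sets_atLeast[OF frechet A1])
    with Xpos[of n] obtain a0 where "a0 \<in> X n" "fset a0 \<subseteq> A1 \<inter> {n..}"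
      unfolding posI by metis
    then have "C a0" unfolding C_def by blast
    then obtain a where a: "C a" "\<And>a'. C a' \<Longrightarrow> to_nat a \<le> to_nat a'"
      using ex_has_least_nat[of C a0 to_nat] by blast
    let ?s' = "s |\<union>| (a |-| s)"
    have "mathias_le (?s', A1) (s, A)"
      by (rule mathias_le_end_extension[OF N]) (use a(1) in \<open>auto simp: C_def A1_def\<close>)
    moreover have "val ?s' A1 n a"
      unfolding val_def
    proof (intro conjI ballI impI notI)
      show "a \<in> X n" "fset a \<subseteq> fset ?s' \<inter> {n..}" using a(1) by (auto simp: C_def)
      fix a' assume a': "a' \<in> X n" "to_nat a' < to_nat a" "fset a' \<subseteq> (fset ?s' \<union> A1) \<inter> {n..}"
      have "fset ?s' \<union> A1 \<subseteq> fset s \<union> A1" using a(1) by (auto simp: C_def)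
      then have "C a'" using a'(1,3) unfolding C_def by blast
      with a(2) a'(2) show False by (meson not_less)
    qed
    ultimately show ?thesis using A1 by blast
  qed
  let ?p = "({||}, UNIV) :: nat fset \<times> nat set"
  have "forces ?P mathias_le \<tau> is_real ?p"
  proof (rule forces_is_realI[OF mathias_le_refl], fold D_def)
    fix n q assume "q \<in> ?P"
    then obtain s A where q: "q = (s, A)" "A \<in> filter_sets F"
      by (auto simp: mathias_conditions_def)
    obtain s' A' a where "A' \<in> filter_sets F" "mathias_le (s', A') q" "val s' A' n a"
      using dense[OF q(2), of s n] q(1) by blast
    moreover from this have "D n (to_nat a) (s', A')" by (blast intro: val_D)
    ultimately show "\<exists>m. \<exists>u\<in>?P. mathias_le u q \<and> D n m u"
      unfolding mathias_conditions_def by blast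
  next
    fix n m m' q assume q: "q \<in> ?P" "D n m q" "D n m' q"
    obtain s A a where 1: "A \<in> filter_sets F" "mathias_le (s, A) q" "val s A n a" "m = to_nat a"
      using D_val[OF q(2,1)] by blast
    \<comment> \<open>Both values get realised at one stronger condition. There each of the two sets
      lies inside the stem, so the minimality of either one excludes a smaller code for the
      other.\<close>
    have "D n m' (s, A)"
      using q(3) mathias_le_trans[OF _ 1(2)] unfolding D_def forces.simps(1) by blast
    moreover have "(s, A) \<in> ?P" using 1(1) by (simp add: mathias_conditions_def)
    ultimately obtain s' A' a' where 2: "mathias_le (s', A') (s, A)" "val s' A' n a'" "m' = to_nat a'"
      using D_val by blast
    have "val s' A' n a" using val_mono[OF 1(3) 2(1)] .
    with 2(2) have "\<not> to_nat a < to_nat a'" "\<not> to_nat a' < to_nat a"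
      unfolding val_def by blast+
    with 1(4) 2(3) show "m = m'" by simp
  qed
  moreover have "\<exists>k. \<exists>u\<in>?P. mathias_le u q \<and> (\<forall>n\<ge>k. \<forall>v\<in>?P. mathias_le v u \<longrightarrow> \<not> D n (f n) v)"
    if q: "q \<in> ?P" for f q
  proof -
    \<comment> \<open>The real \<open>f\<close> is read as a selection \<open>g\<close>; where
      \<open>f n\<close> codes no element of \<open>X n\<close>, an arbitrary element is
      taken.\<close>
    have "\<exists>a. a \<in> X n \<and> (\<forall>a'\<in>X n. f n = to_nat a' \<longrightarrow> a = a')" for n
    proof (cases "\<exists>a\<in>X n. f n = to_nat a")
      case True
      then obtain a where "a \<in> X n" "f n = to_nat a" by blast
      then show ?thesis by auto
    next
      case False
      obtain a where "a \<in> X n" using Xpos[of n] filter_sets_UNIV[of F] unfolding posI by blast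
      with False show ?thesis by blast
    qed
    then obtain g where g: "\<And>n. g n \<in> X n" "\<And>n a. a \<in> X n \<Longrightarrow> f n = to_nat a \<Longrightarrow> g n = a"
      by metis
    have "range g \<notin> positive (fin_power F)" by (rule Y(2)) (use g(1) in \<open>simp add: X_def\<close>)
    then obtain A where A: "A \<in> filter_sets F" "\<And>n. \<not> fset (g n) \<subseteq> A"
      unfolding posI using g(1) Xne by (metis rangeI)
    obtain s B where s: "q = (s, B)" "B \<in> filter_sets F"
      using q by (auto simp: mathias_conditions_def)
    \<comment> \<open>For \<open>n\<close> at least \<open>k\<close> the tail from \<open>n\<close>
      misses \<open>s\<close>, so a set chosen there consists of points added from \<open>A\<close>
      and cannot be \<open>g n\<close>.\<close>
    obtain k where k: "fset s \<subseteq> {..<k}" using finite_nat_iff_bounded finite_fset by blast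
    let ?u = "(s, A \<inter> B)"
    have "?u \<in> ?P" using filter_sets_Int[OF A(1) s(2)] by (simp add: mathias_conditions_def)
    moreover have "mathias_le ?u q" unfolding s(1) by (rule mathias_le_subset) simp
    moreover have "\<not> D n (f n) v" if "n \<ge> k" "v \<in> ?P" "mathias_le v ?u" for n v
    proof
      assume "D n (f n) v"
      with that(2) obtain t C a where t: "mathias_le (t, C) v" "val t C n a" "f n = to_nat a"
        using D_val by blast
      have "mathias_le (t, C) ?u" using t(1) that(3) by (rule mathias_le_trans)
      then have "fset t - fset s \<subseteq> A" by (auto dest: mathias_leD(2))
      moreover have "a \<in> X n" "fset a \<subseteq> fset t \<inter> {n..}" using t(2) by (auto simp: val_def)
      moreover have "fset s \<inter> {n..} = {}" using k that(1) by (auto dest: subsetD)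
      ultimately have "fset a \<subseteq> A" by blast
      moreover have "g n = a" using g(2) \<open>a \<in> X n\<close> t(3) by blast
      ultimately show False using A(2) by blast
    qed
    ultimately show ?thesis by blast
  qed
  moreover have "?p \<in> ?P" by (simp add: mathias_conditions_def filter_sets_UNIV)
  ultimately show ?thesis
    using \<tau> unfolding adds_eventually_different_real_def
      mathias_forces_eventually_different_real_iff D_def
    by blast
qed

theorem theorem19:
  fixes F :: "nat filter"
  assumes proper: "F \<noteq> bot"
    and frechet: "F \<le> cofinite"
  shows "(\<not> adds_eventually_different_real (mathias_conditions F) mathias_le
            \<longleftrightarrow> plus_selective (fin_power F))
       \<and> (plus_selective (fin_power F) \<longleftrightarrow> plus_Ramsey (fin_power F))"
  using plus_selective_imp_not_adds[OF proper frechet] not_plus_selective_imp_adds[OF frechet]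
    plus_selective_imp_plus_Ramsey[OF frechet] plus_Ramsey_imp_plus_selective
  by blast

end
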